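(* Let $G=(V,E)$ be a finite, undirected, connected graph with no loops or parallel edges and with $n=|V|\ge 2$ vertices. Let $P$ be the transition matrix of lazy random walk on $G$, $\pi$ its stationary distribution and $t_{\rm rel}$ its relaxation time. Let $d_x$ be the degree of $x$ and $d_{\min}$ the minimum degree of $G$. Then for every $x\in V$ and every integer $t\ge 0$, $$P^t(x,x)-\pi(x)\le \frac{10\,d_x}{d_{\min}}\,\min\left\{\frac{1}{\sqrt{t+1}},\ \frac{\sqrt{t_{\rm rel}+1}}{t+1}\right\}.$$
   Context: Lazy random walk (LRW) on $G$ is the discrete-time Markov chain on $V$ with transition matrix $P(x,x)=\tfrac12$, $P(x,y)=\tfrac{1}{2d_x}$ if $xy\in E$, and $P(x,y)=0$ otherwise. It is irreducible and reversible with respect to its stationary distribution $\pi(x)=\frac{d_x}{d_{\rm avg}\,n}$, where $d_{\rm avg}$ is the average degree of $G$, and its eigenvalues satisfy $1=\lambda_1>\lambda_2\ge\dots\ge\lambda_n\ge 0$. The relaxation time is $t_{\rm rel}:=(1-\lambda_2)^{-1}$. *)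

theory Defs
  imports "HOL-Analysis.Analysis" "HOL-Computational_Algebra.Polynomial"
begin

text \<open>
  A graph is given by its adjacency relation on a finite type of vertices: an arbitrary
  symmetric irreflexive relation, so there are no loops and no parallel edges.
\<close>

type_synonym 'v graph = "'v \<Rightarrow> 'v \<Rightarrow> bool"

definition simple_graph :: "'v graph \<Rightarrow> bool" where
  "simple_graph E \<longleftrightarrow> symp E \<and> irreflp E"

definition connected_graph :: "'v graph \<Rightarrow> bool" where
  "connected_graph E \<longleftrightarrow> (\<forall>x y. E\<^sup>*\<^sup>* x y)"

definition degree_of :: "('v::finite) graph \<Rightarrow> 'v \<Rightarrow> nat" where
  "degree_of E x = card {y. E x y}"

definition min_degree :: "('v::finite) graph \<Rightarrow> nat" where
  "min_degree E = Min (range (degree_of E))"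

definition avg_degree :: "('v::finite) graph \<Rightarrow> real" where
  "avg_degree E = (\<Sum>x\<in>UNIV. real (degree_of E x)) / real CARD('v)"

definition lazy_walk :: "('v::finite) graph \<Rightarrow> real ^ 'v ^ 'v" where
  "lazy_walk E = (\<chi> x y.
     if x = y then 1 / 2 else if E x y then 1 / (2 * real (degree_of E x)) else 0)"

definition walk_stationary :: "('v::finite) graph \<Rightarrow> 'v \<Rightarrow> real" where
  "walk_stationary E x = real (degree_of E x) / (avg_degree E * real CARD('v))"

text \<open>
  On the type of square matrices, \<open>*\<close> and hence \<open>^\<close> act componentwise;
  this is the power with respect to the matrix product.
\<close>

primrec matrix_power :: "real ^ 'n ^ 'n \<Rightarrow> nat \<Rightarrow> real ^ 'n ^ 'n" where
  "matrix_power A 0 = mat 1"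
| "matrix_power A (Suc k) = A ** matrix_power A k"

definition charpoly :: "real ^ 'n ^ 'n \<Rightarrow> real poly" where
  "charpoly A = det (mat [:0, 1:] - (\<chi> i j. [: A $ i $ j :]))"

text \<open>
  The real eigenvalues in decreasing order, each repeated according to its algebraic
  multiplicity. For a matrix that is reversible with respect to a positive distribution,
  and so similar to a real symmetric one, these are all the eigenvalues.
\<close>

definition eigenvalue_list :: "real ^ 'n ^ 'n \<Rightarrow> real list" where
  "eigenvalue_list A = rev (sorted_list_of_multiset (proots (charpoly A)))"

text \<open>
  List positions start at 0, so position 1 holds the second largest eigenvalue.
\<close>

definition relaxation_time :: "real ^ 'n ^ 'n \<Rightarrow> real" where
  "relaxation_time P = inverse (1 - eigenvalue_list P ! 1)"


text \<open>
  The explicit formula in \<^const>\<open>walk_stationary\<close> is justified by the following facts: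
  it is a probability distribution, the walk is reversible with respect to it, and it is
  therefore stationary.
\<close>

lemma lazy_walk_reversible:
  assumes "simple_graph E"
  shows "walk_stationary E x * lazy_walk E $ x $ y = walk_stationary E y * lazy_walk E $ y $ x"
proof (cases "x = y")
  case False
  have sym: "E x y \<longleftrightarrow> E y x"
    using assms by (auto simp: simple_graph_def dest: sympD)
  show ?thesis
  proof (cases "E x y")
    case True
    then have "degree_of E x \<noteq> 0" "degree_of E y \<noteq> 0"
      using sym by (auto simp: degree_of_def)
    then show ?thesis
      using False True sym by (simp add: lazy_walk_def walk_stationary_def)
  qed (use False sym in \<open>simp add: lazy_walk_def\<close>)
qed simp

lemma degree_of_pos:
  fixes E :: "('v::finite) graph"
  assumes "connected_graph E" "CARD('v) \<ge> 2"
  shows "degree_of E x > 0"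
proof -
  obtain y where "y \<noteq> x"
  proof -
    have "UNIV \<noteq> {x}"
    proof
      assume "UNIV = {x}"
      then have "CARD('v) = card {x}" by (rule arg_cong)
      with assms(2) show False by simp
    qed
    then show ?thesis using that by blast
  qed
  moreover have "E\<^sup>*\<^sup>* x y"
    using assms(1) by (simp add: connected_graph_def)
  ultimately obtain z where "E x z"
    by (metis converse_rtranclpE)
  then show ?thesis
    by (auto simp: degree_of_def card_gt_0_iff)
qed

lemma lazy_walk_row_sum:
  fixes E :: "('v::finite) graph"
  assumes "simple_graph E" "connected_graph E" "CARD('v) \<ge> 2"
  shows "(\<Sum>y\<in>UNIV. lazy_walk E $ x $ y) = 1"
proof -
  have "\<not> E x x"
    using assms(1) by (auto simp: simple_graph_def dest: irreflpD)
  then have "lazy_walk E $ x $ y =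
      (if y = x then 1 / 2 else 0) + (if E x y then 1 / (2 * real (degree_of E x)) else 0)" for y
    by (auto simp: lazy_walk_def)
  then have "(\<Sum>y\<in>UNIV. lazy_walk E $ x $ y) =
      1 / 2 + (\<Sum>y\<in>UNIV. if E x y then 1 / (2 * real (degree_of E x)) else 0)"
    by (simp add: sum.distrib)
  also have "(\<Sum>y\<in>UNIV. if E x y then 1 / (2 * real (degree_of E x)) else 0) =
      real (degree_of E x) * (1 / (2 * real (degree_of E x)))"
    by (simp add: sum.If_cases degree_of_def)
  also have "\<dots> = 1 / 2"
    using degree_of_pos[OF assms(2,3), of x] by simp
  finally show ?thesis by simp
qed

lemma walk_stationary_pos:
  fixes E :: "('v::finite) graph"
  assumes "connected_graph E" "CARD('v) \<ge> 2"
  shows "walk_stationary E x > 0"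
  using degree_of_pos[OF assms]
  by (auto simp: walk_stationary_def avg_degree_def intro!: divide_pos_pos mult_pos_pos sum_pos)

lemma sum_walk_stationary:
  fixes E :: "('v::finite) graph"
  assumes "connected_graph E" "CARD('v) \<ge> 2"
  shows "(\<Sum>x\<in>UNIV. walk_stationary E x) = 1"
proof -
  have "(\<Sum>x\<in>UNIV. real (degree_of E x)) > 0"
    using degree_of_pos[OF assms] by (intro sum_pos) auto
  then show ?thesis
    by (simp add: walk_stationary_def avg_degree_def flip: sum_divide_distrib)
qed

lemma walk_stationary_stationary:
  fixes E :: "('v::finite) graph"
  assumes "simple_graph E" "connected_graph E" "CARD('v) \<ge> 2"
  shows "(\<Sum>x\<in>UNIV. walk_stationary E x * lazy_walk E $ x $ y) = walk_stationary E y"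
  using lazy_walk_row_sum[OF assms, of y]
  by (simp add: lazy_walk_reversible[OF assms(1), of _ y] flip: sum_distrib_left)

end

theory Submission
  imports Defs
begin

text \<open>
  The proof is a Nash inequality for the walk, fed by the geometry of shortest paths.
  Write \<open>D\<close> for the sum of the degrees, \<open>\<delta>\<close> for the minimum degree, \<open>\<pi> = d / D\<close>, and
  let \<open>f\<^sub>t(y) = P\<^sup>t(y, x) / \<pi>(x)\<close> be the density of the walk. With the inner product of
  \<open>L\<^sup>2(\<pi>)\<close> and \<open>h = f\<^sub>0 - 1\<close>, the quantity to be bounded is \<open>\<pi>(x)\<close> times the moment
  \<open>a\<^sub>t = \<langle>h, P\<^sup>t h\<rangle> = f\<^sub>t(x) - 1\<close>. Reversibility makes \<open>P\<close> self-adjoint and laziness makes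
  it positive semidefinite, so \<open>a\<close> is nonnegative and decreasing, its decrements at odd times
  dominate the next ones, and the decrement at time \<open>2t\<close> is
  the Dirichlet energy of \<open>f\<^sub>t\<close>, the sum of \<open>(f\<^sub>t(u) - f\<^sub>t(v))\<^sup>2\<close> over arcs divided by \<open>4D\<close>.

  The energy is large when \<open>M = f\<^sub>t(x) - 1\<close> is large (lemma \<open>Nash_inequality\<close>). Indeed \<open>f\<^sub>t\<close>
  has to fall from \<open>1 + M\<close> at \<open>x\<close> to at most \<open>1 + M / 2\<close> somewhere. Along a shortest path to
  such a place, of length \<open>r\<close>, this costs energy of order \<open>M\<^sup>2 / r\<close>. On the other hand the
  neighbours of the first \<open>r - 1\<close> path vertices all carry density above \<open>1 + M / 2\<close>; a
  vertex has at most three neighbours on a shortest path, so their total degree is at least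
  of order \<open>r \<delta>\<^sup>2\<close>, and as the total mass is \<open>D\<close>, \<open>r\<close> is at most of order \<open>D / (\<delta>\<^sup>2 M)\<close>.
  Together the energy sum is at least of order \<open>M\<^sup>3 \<delta>\<^sup>2 / D\<close>. A path of length 1 has no such
  neighbours, and there all the edges at \<open>x\<close> are used (lemma \<open>Nash_adjacent_case\<close>).

  Hence \<open>b = a \<delta> / D\<close> satisfies \<open>b\<^sub>t - b\<^sub>t\<^sub>+\<^sub>1 \<ge> b\<^sub>t\<^sup>3 / 96\<close>, which gives decay of order
  \<open>1 / sqrt t\<close>. Since \<open>h\<close> has mean zero, also \<open>b\<^sub>t\<^sub>+\<^sub>1 \<le> \<lambda>\<^sub>2 b\<^sub>t\<close>; spending the first half of the
  time on the cubic inequality and the second half on the geometric one gives the bound with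
  the relaxation time (lemma \<open>mixed_decay_bound\<close>).

  To identify \<open>\<lambda>\<^sub>2\<close> no diagonalization is made. The maximum \<open>\<mu>\<close> of the Rayleigh quotient on
  functions of mean zero is attained at an eigenvector, and \<open>\<mu> < 1\<close> by connectedness. As 1 is
  a simple root of the characteristic polynomial and the largest one, the second entry of the
  list of eigenvalues lies in \<open>[\<mu>, 1)\<close>.
\<close>

section \<open>Semidefinite forms\<close>

text \<open>
  Semidefiniteness on a subspace suffices, which matters for the form that expresses the spectral
  gap: it is nonnegative only on functions of mean zero.
\<close>

lemma semidefinite_form_Cauchy_Schwarz:
  fixes B :: "'a::real_vector \<Rightarrow> 'a \<Rightarrow> real"
  assumes B: "bilinear B" and sym: "\<And>f g. B f g = B g f"
    and S: "subspace S" and nonneg: "\<And>f. f \<in> S \<Longrightarrow> B f f \<ge> 0"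
    and fg: "f \<in> S" "g \<in> S"
  shows "(B f g)\<^sup>2 \<le> B f f * B g g"
proof -
  have quadratic: "0 \<le> B f f + 2 * c * B f g + c\<^sup>2 * B g g" for c
  proof -
    have "B (f + c *\<^sub>R g) (f + c *\<^sub>R g) \<ge> 0"
      using fg S by (intro nonneg) (simp add: subspace_def)
    then show ?thesis
      by (simp add: bilinear_ladd[OF B] bilinear_radd[OF B] bilinear_lmul[OF B]
          bilinear_rmul[OF B] sym[of g f] power2_eq_square algebra_simps)
  qed
  show ?thesis
  proof (cases "B g g = 0")
    case True
    have "B f g = 0"
    proof (rule ccontr)
      assume "B f g \<noteq> 0"
      then show False
        using quadratic[of "- (B f f + 1) / (2 * B f g)"] True by (simp add: field_simps)
    qed
    then show ?thesis using True by simp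
  next
    case False
    then have "B g g > 0" using nonneg[OF fg(2)] by simp
    then show ?thesis
      using quadratic[of "- B f g / B g g"]
      by (simp add: field_simps power2_eq_square)
  qed
qed

section \<open>Decay of real sequences\<close>

text \<open>
  The discrete form of the fact that solutions of \<open>b' = - k b\<^sup>3\<close> satisfy \<open>(1 / b\<^sup>2)' = 2 k\<close>.
  The inequality is kept in multiplied form so that \<open>b = 0\<close> needs no separate treatment.
\<close>

lemma cubic_decay_bound:
  fixes b :: "nat \<Rightarrow> real"
  assumes nonneg: "\<And>s. 0 \<le> b s" and b0: "b 0 \<le> 1" and k: "0 \<le> k" "k \<le> 1"
    and step: "\<And>s. k * b s ^ 3 \<le> b s - b (Suc s)"
  shows "(b s)\<^sup>2 * (1 + 2 * k * real s) \<le> 1"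
proof (induction s)
  case 0
  then show ?case using b0 nonneg[of 0] by (simp add: power_le_one)
next
  case (Suc s)
  define q where "q = (b s)\<^sup>2"
  have q0: "0 \<le> q" by (simp add: q_def)
  have qA: "q * (1 + 2 * k * real s) \<le> 1" using Suc by (simp add: q_def)
  have "q * 1 \<le> q * (1 + 2 * k * real s)"
    using q0 k by (intro mult_left_mono) auto
  with qA have q1: "q \<le> 1" by simp
  have kq: "0 \<le> k * q" "k * q \<le> 1"
    using k q0 q1 by (auto intro: mult_le_one)
  have "b (Suc s) \<le> b s * (1 - k * q)"
    using step[of s] by (simp add: q_def power2_eq_square power3_eq_cube algebra_simps)
  then have "(b (Suc s))\<^sup>2 \<le> (b s * (1 - k * q))\<^sup>2"
    using nonneg by (intro power_mono) auto
  then have "(b (Suc s))\<^sup>2 * (1 + 2 * k * real (Suc s))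
      \<le> q * (1 - k * q)\<^sup>2 * (1 + 2 * k * real (Suc s))"
    using k by (intro mult_right_mono) (auto simp: q_def power_mult_distrib)
  also have "\<dots> = (1 - k * q)\<^sup>2 * (q * (1 + 2 * k * real s) + 2 * (k * q))"
    by (simp add: algebra_simps)
  also have "\<dots> \<le> (1 - k * q)\<^sup>2 * (1 + 2 * (k * q))"
    using qA by (intro mult_left_mono) auto
  also have "\<dots> = 1 - (k * q)\<^sup>2 * (3 - 2 * (k * q))"
    by (simp add: power2_eq_square power3_eq_cube algebra_simps)
  also have "\<dots> \<le> 1" using kq by simp
  finally show ?case .
qed

text \<open>
  Bernoulli's inequality for \<open>(1 - e)\<close> to the power \<open>- 2 s\<close>, in the form in which it combines with
  the preceding estimate into a rational bound.
\<close>

lemma geometric_decay_bound: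
  fixes b :: "nat \<Rightarrow> real"
  assumes nonneg: "\<And>s. 0 \<le> b s" and e: "0 \<le> e" "e \<le> 1"
    and step: "\<And>s. b (Suc s) \<le> (1 - e) * b s"
  shows "(b (t + s))\<^sup>2 * (1 + 2 * e * real s) \<le> (b t)\<^sup>2"
proof (induction s)
  case 0
  then show ?case by simp
next
  case (Suc s)
  define A where "A = 1 + 2 * e * real s"
  have A: "A \<ge> 1" using e by (simp add: A_def)
  have "(b (t + Suc s))\<^sup>2 \<le> ((1 - e) * b (t + s))\<^sup>2"
    using step[of "t + s"] nonneg by (intro power_mono) auto
  then have "(b (t + Suc s))\<^sup>2 * (A + 2 * e) \<le> ((1 - e) * b (t + s))\<^sup>2 * (A + 2 * e)"
    using e A by (intro mult_right_mono) auto
  also have "A + 2 * e = 1 + 2 * e * real (Suc s)"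
    by (simp add: A_def algebra_simps)
  also have "((1 - e) * b (t + s))\<^sup>2 * (1 + 2 * e * real (Suc s))
      = (b (t + s))\<^sup>2 * ((1 - e)\<^sup>2 * (A + 2 * e))"
    unfolding power_mult_distrib by (simp add: A_def algebra_simps)
  also have "(1 - e)\<^sup>2 * (A + 2 * e) = A - (e * (2 - e) * (A - 1) + e\<^sup>2 * (3 - 2 * e))"
    by (simp add: power2_eq_square algebra_simps)
  also have "(b (t + s))\<^sup>2 * \<dots> \<le> (b (t + s))\<^sup>2 * A"
  proof (intro mult_left_mono)
    have "0 \<le> e * (2 - e) * (A - 1)" "0 \<le> e\<^sup>2 * (3 - 2 * e)"
      using A e by auto
    then show "A - (e * (2 - e) * (A - 1) + e\<^sup>2 * (3 - 2 * e)) \<le> A" by linarith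
  qed simp
  also have "\<dots> \<le> (b t)\<^sup>2" using Suc by (simp add: A_def)
  finally show ?case .
qed

text \<open>
  The second estimate splits \<open>n = t + s\<close> into nearly equal halves, with cubic decay up to time
  \<open>t\<close> and geometric decay afterwards.
\<close>

lemma mixed_decay_bound:
  fixes b :: "nat \<Rightarrow> real"
  assumes nonneg: "\<And>s. 0 \<le> b s" and b0: "b 0 \<le> 1"
    and cubic: "\<And>s. 1 / 96 * b s ^ 3 \<le> b s - b (Suc s)"
    and geometric: "\<And>s. b (Suc s) \<le> (1 - inverse T) * b s" and T: "1 \<le> T"
  shows "b n \<le> 10 * min (1 / sqrt (real n + 1)) (sqrt (T + 1) / (real n + 1))"
proof -
  have sq: "(b t)\<^sup>2 * (1 + real t / 48) \<le> 1" for t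
    using cubic_decay_bound[of b "1/96" t] nonneg b0 cubic by simp
  have "(b n)\<^sup>2 * ((real n + 1) / 100) \<le> (b n)\<^sup>2 * (1 + real n / 48)"
    by (intro mult_left_mono) (auto simp: field_simps)
  also note sq
  finally have "(b n)\<^sup>2 \<le> 100 / (real n + 1)" by (simp add: field_simps)
  then have "b n \<le> sqrt (100 / (real n + 1))" by (simp add: real_le_rsqrt)
  also have "\<dots> = 10 * (1 / sqrt (real n + 1))" by (simp add: real_sqrt_divide)
  finally have A: "b n \<le> 10 * (1 / sqrt (real n + 1))" .
  define t s where "t = n div 2" and "s = n - t"
  have ts: "n = t + s" "real n \<le> 2 * real t + 1" "real n \<le> 2 * real s"
    unfolding t_def s_def by linarith+
  \<comment> \<open>Geometric decay contributes one factor \<open>n + 1\<close>, the cubic decay the other one.\<close>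
  have gap: "1 + 2 * inverse T * real s \<ge> (real n + 1) / (T + 1)"
  proof -
    have "(real n + 1) / (T + 1) \<le> (T + real n) / T"
      using T by (simp add: field_simps)
    also have "\<dots> = 1 + inverse T * real n" using T by (simp add: field_simps)
    also have "\<dots> \<le> 1 + inverse T * (2 * real s)"
      using ts T by (intro add_left_mono mult_left_mono) auto
    finally show ?thesis by simp
  qed
  have "(b n)\<^sup>2 * ((real n + 1) / (T + 1) * ((real n + 1) / 100))
      \<le> (b n)\<^sup>2 * ((1 + 2 * inverse T * real s) * (1 + real t / 48))"
    using gap T ts by (intro mult_left_mono mult_mono) auto
  also have "\<dots> = (b (t + s))\<^sup>2 * (1 + 2 * inverse T * real s) * (1 + real t / 48)"
    using ts(1) by simp
  also have "\<dots> \<le> (b t)\<^sup>2 * (1 + real t / 48)"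
    using T by (intro mult_right_mono geometric_decay_bound nonneg geometric)
      (auto simp: inverse_le_1_iff)
  also note sq
  finally have "(b n)\<^sup>2 \<le> 100 * (T + 1) / (real n + 1)\<^sup>2"
    using T by (simp add: pos_le_divide_eq pos_divide_le_eq power2_eq_square mult.assoc)
  then have "b n \<le> sqrt (100 * (T + 1) / (real n + 1)\<^sup>2)" by (rule real_le_rsqrt)
  also have "\<dots> = 10 * (sqrt (T + 1) / (real n + 1))"
    unfolding real_sqrt_divide real_sqrt_mult by simp
  finally show ?thesis using A by simp
qed

section \<open>Roots of the characteristic polynomial\<close>

text \<open>
  An element below the maximum can only raise the second entry, while a maximum of multiplicity
  one cannot occupy it.
\<close>

lemma second_largest_of_mset:
  fixes M :: "'a::linorder multiset"
  assumes count: "count M m = 1" and max: "\<And>y. y \<in># M \<Longrightarrow> y \<le> m"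
    and a: "a \<in># M" "a \<noteq> m"
  shows "a \<le> rev (sorted_list_of_multiset M) ! 1"
    and "rev (sorted_list_of_multiset M) ! 1 < m"
proof -
  define N where "N = M - {#m#}"
  have M: "M = add_mset m N"
    using count by (simp add: N_def flip: count_greater_zero_iff)
  have "m \<notin># N" using count M by (simp add: not_in_iff)
  then have less: "y < m" if "y \<in># N" for y
    using that max[of y] M by (metis insert_iff le_neq_trans set_mset_add_mset_insert)
  have aN: "a \<in># N" using a M by simp
  define xs where "xs = sorted_list_of_multiset N"
  have xs: "set xs = set_mset N" "sorted xs" by (auto simp: xs_def)
  have "sorted_list_of_multiset M = xs @ [m]"
    using xs less by (simp add: M xs_def[symmetric] sorted_insort_is_snoc less_imp_le)
  moreover have ne: "xs \<noteq> []" using aN xs by auto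
  ultimately have second: "rev (sorted_list_of_multiset M) ! 1 = last xs"
    by (simp add: hd_rev flip: hd_conv_nth)
  have sorted_last: "y \<le> last ys" if "sorted ys" "y \<in> set ys" for y and ys :: "'a list"
    using that by (induction ys) auto
  show "rev (sorted_list_of_multiset M) ! 1 < m"
    using last_in_set[OF ne] xs(1) less second by simp
  show "a \<le> rev (sorted_list_of_multiset M) ! 1"
    using sorted_last[OF xs(2)] aN xs(1) second by simp
qed

lemma poly_det:
  fixes A :: "real poly ^ 'n ^ 'n"
  shows "poly (det A) c = det (\<chi> i j. poly (A $ i $ j) c)"
  by (simp add: det_def poly_sum poly_prod)

lemma poly_charpoly:
  fixes A :: "real ^ 'n ^ 'n"
  shows "poly (charpoly A) c = det (mat c - A)"
  unfolding charpoly_def poly_det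
  by (intro arg_cong[where f = det]) (simp add: vec_eq_iff mat_def)

lemma det_zero_iff_kernel:
  fixes A :: "real ^ 'n ^ 'n"
  shows "det A = 0 \<longleftrightarrow> (\<exists>v. v \<noteq> 0 \<and> A *v v = 0)"
  using invertible_det_nz[of A] matrix_left_invertible_ker[of A] invertible_left_inverse[of A]
  by metis

lemma charpoly_root_iff_eigenvalue:
  fixes A :: "real ^ 'n ^ 'n"
  shows "poly (charpoly A) c = 0 \<longleftrightarrow> (\<exists>v. v \<noteq> 0 \<and> A *v v = c *\<^sub>R v)"
proof -
  have "mat c *v v = c *\<^sub>R v" for v :: "real ^ 'n"
    by (simp add: vec_eq_iff matrix_vector_mult_def mat_def if_distrib[of "\<lambda>z. z * _"] cong: if_cong)
  then have "(mat c - A) *v v = 0 \<longleftrightarrow> A *v v = c *\<^sub>R v" for v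
    by (auto simp: matrix_vector_mult_diff_rdistrib)
  then show ?thesis
    by (simp add: poly_charpoly det_zero_iff_kernel)
qed

text \<open>
  Expanding the determinant linearly in row \<open>k\<close>, every summand other than the \<open>k\<close>-th one has
  two equal rows.
\<close>

lemma det_row_combination:
  fixes A :: "'a::comm_ring_1 ^ 'n ^ 'n"
  shows "det (\<chi> i. if i = k then (\<Sum>j\<in>UNIV. c j *s A $ j) else A $ i) = c k * det A"
proof -
  have summand: "det (\<chi> i. if i = k then c j *s A $ j else A $ i) = (if j = k then c k * det A else 0)"
    for j
  proof -
    have "det (\<chi> i. if i = k then c j *s A $ j else A $ i)
        = c j * det (\<chi> i. if i = k then A $ j else A $ i)"
      by (rule det_row_mul)
    also have "det (\<chi> i. if i = k then A $ j else A $ i) = (if j = k then det A else 0)"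
    proof (cases "j = k")
      case True
      then have "(\<chi> i. if i = k then A $ j else A $ i) = A" by (simp add: vec_eq_iff)
      then show ?thesis using True by simp
    next
      case False
      then show ?thesis
        by (simp add: det_identical_rows[of j k] row_def vec_eq_iff)
    qed
    finally show ?thesis by simp
  qed
  show ?thesis
    by (simp add: det_linear_row_sum summand)
qed

text \<open>
  The combination of the rows of \<open>X - A\<close> with the weights \<open>w\<close> is \<open>(X - c) w\<close>. Putting this
  combination into a single row \<open>k\<close> splits off one factor \<open>X - c\<close>, and what remains is the determinant
  of \<open>X - A\<close> with row \<open>k\<close> replaced by \<open>w\<close>. This cofactor does not vanish at \<open>c\<close>: a kernel vector
  would have \<open>w\<close>-mean zero and be an eigenvector in all rows but \<open>k\<close>, hence also in row \<open>k\<close>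
  because the weighted rows of \<open>c - A\<close> sum to zero. Thus the algebraic multiplicity is obtained
  without diagonalizing \<open>A\<close>.
\<close>

lemma charpoly_simple_root:
  fixes A :: "real ^ 'n ^ 'n" and w :: "'n \<Rightarrow> real"
  assumes left: "\<And>j. (\<Sum>i\<in>UNIV. w i * A $ i $ j) = c * w j"
    and w: "\<And>i. w i > 0"
    and right: "\<And>v. A *v v = c *\<^sub>R v \<Longrightarrow> (\<Sum>i\<in>UNIV. w i * v $ i) = 0 \<Longrightarrow> v = 0"
  shows "order c (charpoly A) = 1"
proof -
  fix k :: 'n
  have const_sum: "(\<Sum>i\<in>I. [: f i :]) = [: \<Sum>i\<in>I. f i :]" for I :: "'n set" and f :: "'n \<Rightarrow> real"
    by (simp add: poly_eq_iff coeff_sum coeff_pCons split: nat.split)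
  define X where "X = mat [:0, 1:] - (\<chi> i j. [: A $ i $ j :])"
  define R where "R = (\<chi> i. if i = k then (\<chi> j. [: w j :]) else X $ i)"
  have entry: "X $ i $ j = (if i = j then [:0, 1:] else 0) - [: A $ i $ j :]" for i j
    by (simp add: X_def mat_def)
  have "(\<Sum>i\<in>UNIV. [:w i:] *s X $ i) = [:- c, 1:] *s (\<chi> j. [: w j :])"
  proof -
    have "(\<Sum>i\<in>UNIV. [:w i:] * X $ i $ j) = [:- c, 1:] * [:w j:]" for j
    proof -
      have "(\<Sum>i\<in>UNIV. [:w i:] * X $ i $ j)
          = (\<Sum>i\<in>UNIV. (if i = j then [:0, w i:] else 0) - [: w i * A $ i $ j :])"
        by (intro sum.cong) (auto simp: entry)
      also have "\<dots> = [:0, w j:] - [: \<Sum>i\<in>UNIV. w i * A $ i $ j :]"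
        by (simp add: sum_subtractf const_sum)
      finally show ?thesis by (simp add: left)
    qed
    then show ?thesis by (simp add: vec_eq_iff sum_component)
  qed
  then have "(\<chi> i. if i = k then (\<Sum>j\<in>UNIV. [:w j:] *s X $ j) else X $ i)
      = (\<chi> i. if i = k then [:- c, 1:] *s (\<chi> j. [: w j :]) else X $ i)"
    by (simp add: vec_eq_iff)
  then have factor: "[:w k:] * charpoly A = [:- c, 1:] * det R"
    using det_row_combination[of k "\<lambda>i. [:w i:]" X]
      det_row_mul[of k "[:- c, 1:]" "\<lambda>_. \<chi> j. [: w j :]" "\<lambda>i. X $ i"]
    by (simp add: charpoly_def X_def R_def)
  have "poly (det R) c \<noteq> 0"
  proof
    define Rc where "Rc = (\<chi> i j. poly (R $ i $ j) c)"
    assume "poly (det R) c = 0"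
    then obtain v where v: "v \<noteq> 0" "Rc *v v = 0"
      by (auto simp: poly_det det_zero_iff_kernel Rc_def)
    define u where "u = c *\<^sub>R v - A *v v"
    have rows: "(\<Sum>j\<in>UNIV. Rc $ i $ j * v $ j) = 0" for i
      using v(2) by (simp add: vec_eq_iff matrix_vector_mult_def)
    have mean: "(\<Sum>i\<in>UNIV. w i * v $ i) = 0"
      using rows[of k] by (simp add: Rc_def R_def)
    have other: "u $ i = 0" if "i \<noteq> k" for i
    proof -
      have "(\<Sum>j\<in>UNIV. Rc $ i $ j * v $ j) = (\<Sum>j\<in>UNIV. (if i = j then c * v $ j else 0) - A $ i $ j * v $ j)"
        using that by (intro sum.cong) (auto simp: Rc_def R_def entry algebra_simps)
      also have "\<dots> = u $ i" by (simp add: u_def sum_subtractf matrix_vector_mult_def)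
      finally show ?thesis using rows[of i] by simp
    qed
    have "(\<Sum>i\<in>UNIV. w i * (A *v v) $ i) = (\<Sum>j\<in>UNIV. \<Sum>i\<in>UNIV. w i * A $ i $ j * v $ j)"
      by (subst sum.swap) (simp add: matrix_vector_mult_def sum_distrib_left mult.assoc)
    also have "\<dots> = c * (\<Sum>j\<in>UNIV. w j * v $ j)"
      by (simp add: left flip: sum_distrib_right) (simp add: sum_distrib_left mult.assoc)
    finally have "(\<Sum>i\<in>UNIV. w i * u $ i) = 0"
      using mean by (simp add: u_def right_diff_distrib sum_subtractf)
         (metis (no_types, lifting) mult.left_commute mult_zero_right sum.cong sum_distrib_left)
    moreover have "(\<Sum>i\<in>UNIV. w i * u $ i) = w k * u $ k"
      using other by (subst sum.remove[of _ k]) auto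
    ultimately have "u $ k = 0" using w[of k] by simp
    then have "u = 0" using other by (metis vec_eq_iff zero_index)
    then have "v = 0" using right[of v] mean by (simp add: u_def)
    with v(1) show False by simp
  qed
  then have R: "det R \<noteq> 0" "order c (det R) = 0" by (auto simp: order_0I)
  have "order c (charpoly A) = order c (smult (w k) (charpoly A))"
    using w[of k] by (simp add: order_smult)
  also have "smult (w k) (charpoly A) = [:- c, 1:] * det R"
    using factor by simp
  also have "order c \<dots> = order c [:- c, 1:] + order c (det R)"
    using R(1) by (intro order_mult) (simp only: mult_eq_0_iff, simp)
  also have "order c [:- c, 1:] = 1"
    using order_power_n_n[of c 1] by simp
  finally show ?thesis using R by simp
qed

section \<open>Geodesics\<close>

text \<open>
  A walk of minimal length from \<open>x\<close> to the set \<open>Z\<close>. The fourth property says that it has no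
  shortcuts, for any shortcut would lead to \<open>Z\<close> earlier; the fifth one that the ball of radius
  \<open>r - 1\<close> around \<open>x\<close> misses \<open>Z\<close>.
\<close>

lemma geodesic_to_set:
  assumes "R\<^sup>*\<^sup>* x z" "z \<in> Z"
  obtains p and r :: nat where "p 0 = x" "p r \<in> Z" "\<And>i. i < r \<Longrightarrow> R (p i) (p (Suc i))"
    and "\<And>i j m. j \<le> r \<Longrightarrow> (R ^^ m) (p i) (p j) \<Longrightarrow> i \<le> r \<Longrightarrow> j \<le> i + m"
    and "\<And>k y. (R ^^ k) x y \<Longrightarrow> k < r \<Longrightarrow> y \<notin> Z"
proof -
  define r where "r = (LEAST k. \<exists>y. (R ^^ k) x y \<and> y \<in> Z)"
  have "\<exists>k y. (R ^^ k) x y \<and> y \<in> Z"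
    using assms by (auto simp: rtranclp_power)
  then have "\<exists>y. (R ^^ r) x y \<and> y \<in> Z" unfolding r_def by (rule LeastI_ex)
  then obtain y where "(R ^^ r) x y" "y \<in> Z" by blast
  then obtain p where p: "p 0 = x" "p r \<in> Z" "\<And>i. i < r \<Longrightarrow> R (p i) (p (Suc i))"
    by (auto simp: relpowp_fun_conv)
  have least: "r \<le> k" if "(R ^^ k) x y" "y \<in> Z" for k y
    unfolding r_def using that by (intro Least_le) blast
  have piece: "(R ^^ k) (p i) (p (i + k))" if "i + k \<le> r" for i k
    unfolding relpowp_fun_conv using that p(3) by (intro exI[of _ "\<lambda>l. p (i + l)"]) auto
  show thesis
  proof (rule that[of p r])
    fix i j m assume ij: "j \<le> r" "(R ^^ m) (p i) (p j)" "i \<le> r"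
    have "(R ^^ i) x (p i)" "(R ^^ (r - j)) (p j) (p r)"
      using piece[of 0 i] piece[of j "r - j"] p(1) ij by auto
    then have "(R ^^ (i + m + (r - j))) x (p r)"
      using ij(2) by (auto simp: relpowp_add)
    then show "j \<le> i + m" using least p(2) ij(1) by fastforce
  next
    show "y \<notin> Z" if "(R ^^ k) x y" "k < r" for k y
      using least[OF that(1)] that(2) by auto
  qed (use p in auto)
qed

section \<open>Powers of a matrix\<close>

lemma matrix_power_add: "matrix_power A (m + n) = matrix_power A m ** matrix_power A n"
  by (induction m) (simp_all add: matrix_mul_assoc)

lemma matrix_power_Suc_vector: "matrix_power A (Suc n) *v f = A *v (matrix_power A n *v f)"
  by (simp add: matrix_vector_mul_assoc)

lemma matrix_power_add_vector: "matrix_power A (m + n) *v f = matrix_power A m *v (matrix_power A n *v f)"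
  by (simp add: matrix_vector_mul_assoc matrix_power_add)

section \<open>The walk as a self-adjoint operator\<close>

definition total_degree :: "('v::finite) graph \<Rightarrow> real" where
  "total_degree E = (\<Sum>x\<in>UNIV. real (degree_of E x))"

definition dirichlet_sum :: "('v::finite) graph \<Rightarrow> real ^ 'v \<Rightarrow> real" where
  "dirichlet_sum E f = (\<Sum>(u, v)\<in>{(u, v). E u v}. (f $ u - f $ v)\<^sup>2)"

locale connected_simple_graph =
  fixes E :: "('v::finite) graph"
  assumes simple: "simple_graph E" and connected: "connected_graph E"
    and two_vertices: "CARD('v) \<ge> 2"
begin

abbreviation "stat \<equiv> walk_stationary E"
abbreviation "P \<equiv> lazy_walk E"
abbreviation "deg x \<equiv> real (degree_of E x)"

definition stat_inner :: "real ^ 'v \<Rightarrow> real ^ 'v \<Rightarrow> real" where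
  "stat_inner f g = (\<Sum>x\<in>UNIV. stat x * f $ x * g $ x)"

lemma adjacent_sym: "E u v \<longleftrightarrow> E v u"
  using simple by (auto simp: simple_graph_def dest: sympD)

lemma not_adjacent_self: "\<not> E u u"
  using simple by (auto simp: simple_graph_def dest: irreflpD)

lemma deg_pos: "deg u > 0"
  using degree_of_pos[OF connected two_vertices, of u] by simp

lemma total_degree_pos: "total_degree E > 0"
  unfolding total_degree_def by (intro sum_pos deg_pos) auto

lemma stat_eq: "stat u = deg u / total_degree E"
  by (simp add: walk_stationary_def avg_degree_def total_degree_def)

lemma stat_pos: "stat u > 0"
  by (rule walk_stationary_pos[OF connected two_vertices])

lemma stat_inner_commute: "stat_inner f g = stat_inner g f"
  by (simp add: stat_inner_def mult_ac)

lemma stat_inner_add_left: "stat_inner (f + g) h = stat_inner f h + stat_inner g h"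
  by (simp add: stat_inner_def algebra_simps sum.distrib)

lemma stat_inner_scaleR_left: "stat_inner (c *\<^sub>R f) h = c * stat_inner f h"
  by (simp add: stat_inner_def algebra_simps sum_distrib_left)

lemma stat_inner_diff_left: "stat_inner (f - g) h = stat_inner f h - stat_inner g h"
  by (simp add: stat_inner_def algebra_simps sum_subtractf)

lemma stat_inner_add_right: "stat_inner h (f + g) = stat_inner h f + stat_inner h g"
  by (simp add: stat_inner_def algebra_simps sum.distrib)

lemma stat_inner_scaleR_right: "stat_inner h (c *\<^sub>R f) = c * stat_inner h f"
  by (simp add: stat_inner_def algebra_simps sum_distrib_left)

lemma stat_inner_diff_right: "stat_inner h (f - g) = stat_inner h f - stat_inner h g"
  by (simp add: stat_inner_def algebra_simps sum_subtractf)

lemmas stat_inner_linear = stat_inner_add_left stat_inner_scaleR_left stat_inner_diff_left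
  stat_inner_add_right stat_inner_scaleR_right stat_inner_diff_right

lemma stat_inner_zero [simp]: "stat_inner 0 f = 0" "stat_inner f 0 = 0"
  by (simp_all add: stat_inner_def)

lemma stat_inner_self_nonneg: "stat_inner f f \<ge> 0"
  unfolding stat_inner_def using stat_pos by (intro sum_nonneg) (simp add: mult.assoc less_imp_le)

lemma stat_inner_self_eq_0_iff: "stat_inner f f = 0 \<longleftrightarrow> f = 0"
proof -
  have "stat_inner f f = 0 \<longleftrightarrow> (\<forall>x\<in>UNIV. stat x * f $ x * f $ x = 0)"
    unfolding stat_inner_def using stat_pos
    by (intro sum_nonneg_eq_0_iff) (auto simp: mult.assoc less_imp_le)
  then show ?thesis using stat_pos by (auto simp: vec_eq_iff less_le)
qed

lemma stat_inner_one_one: "stat_inner 1 1 = 1"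
  using sum_walk_stationary[OF connected two_vertices] by (simp add: stat_inner_def)

lemma walk_fixes_one: "P *v 1 = 1"
  using lazy_walk_row_sum[OF simple connected two_vertices]
  by (simp add: vec_eq_iff matrix_vector_mult_def)

lemma walk_self_adjoint: "stat_inner (P *v f) g = stat_inner f (P *v g)"
proof -
  have "stat_inner (P *v f) g = (\<Sum>x\<in>UNIV. \<Sum>y\<in>UNIV. stat x * P $ x $ y * f $ y * g $ x)"
    by (simp add: stat_inner_def matrix_vector_mult_def sum_distrib_left sum_distrib_right mult_ac)
  also have "\<dots> = (\<Sum>x\<in>UNIV. \<Sum>y\<in>UNIV. stat y * P $ y $ x * f $ y * g $ x)"
    by (simp add: lazy_walk_reversible[OF simple])
  also have "\<dots> = (\<Sum>y\<in>UNIV. \<Sum>x\<in>UNIV. stat y * P $ y $ x * f $ y * g $ x)"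
    by (rule sum.swap)
  also have "\<dots> = stat_inner f (P *v g)"
    by (simp add: stat_inner_def matrix_vector_mult_def sum_distrib_left mult_ac)
  finally show ?thesis .
qed

lemma walk_preserves_mean: "stat_inner (P *v f) 1 = stat_inner f 1"
  by (simp add: walk_self_adjoint walk_fixes_one)

lemma sum_arcs_fst: "(\<Sum>(u, v)\<in>{(u, v). E u v}. F u) = (\<Sum>u\<in>UNIV. deg u * F u)"
proof -
  have "{(u, v). E u v} = (SIGMA u:UNIV. {v. E u v})" by auto
  then show ?thesis
    by (simp add: degree_of_def flip: sum.Sigma)
qed

lemma sum_arcs_swap: "(\<Sum>(u, v)\<in>{(u, v). E u v}. F u v) = (\<Sum>(u, v)\<in>{(u, v). E u v}. F v u)"
  by (rule sum.reindex_bij_witness[of _ prod.swap prod.swap]) (auto simp: adjacent_sym)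

text \<open>
  The walk stays put with probability one half; the other half is the adjacency form, since
  \<open>\<pi>(u) P(u, v) = 1 / (2 D)\<close> on arcs.
\<close>

lemma stat_inner_walk:
  "2 * total_degree E * stat_inner f (P *v f)
     = total_degree E * stat_inner f f + (\<Sum>(u, v)\<in>{(u, v). E u v}. f $ u * f $ v)"
proof -
  have entry: "deg u * P $ u $ v = (if u = v then deg u / 2 else 0) + (if E u v then 1 / 2 else 0)" for u v
    using not_adjacent_self[of u] deg_pos[of u] by (auto simp: lazy_walk_def)
  have "2 * total_degree E * stat_inner f (P *v f)
      = (\<Sum>u\<in>UNIV. \<Sum>v\<in>UNIV. 2 * (deg u * P $ u $ v) * (f $ u * f $ v))"
    using total_degree_pos
    by (simp add: stat_inner_def stat_eq matrix_vector_mult_def sum_distrib_left sum_divide_distrib mult_ac)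
  also have "\<dots> = (\<Sum>u\<in>UNIV. (\<Sum>v\<in>UNIV. if u = v then deg u * (f $ u * f $ v) else 0)
      + (\<Sum>v\<in>UNIV. if E u v then f $ u * f $ v else 0))"
    unfolding entry sum.distrib[symmetric] by (intro sum.cong refl) (auto simp: algebra_simps)
  also have "\<dots> = (\<Sum>u\<in>UNIV. deg u * (f $ u * f $ u)) + (\<Sum>u\<in>UNIV. \<Sum>v\<in>UNIV. if E u v then f $ u * f $ v else 0)"
    by (simp add: sum.distrib)
  also have "(\<Sum>u\<in>UNIV. \<Sum>v\<in>UNIV. if E u v then f $ u * f $ v else 0)
      = (\<Sum>(u, v)\<in>{(u, v). E u v}. f $ u * f $ v)"
  proof -
    have "{(u, v). E u v} = (SIGMA u:UNIV. {v. E u v})" by auto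
    then show ?thesis by (simp add: sum.If_cases flip: sum.Sigma)
  qed
  also have "(\<Sum>u\<in>UNIV. deg u * (f $ u * f $ u)) = total_degree E * stat_inner f f"
    using total_degree_pos
    by (simp add: stat_inner_def stat_eq sum_distrib_left mult_ac)
  finally show ?thesis .
qed

lemma sum_arcs_squares:
  "(\<Sum>(u, v)\<in>{(u, v). E u v}. (f $ u)\<^sup>2 + (f $ v)\<^sup>2) = 2 * total_degree E * stat_inner f f"
proof -
  have "(\<Sum>(u, v)\<in>{(u, v). E u v}. (f $ u)\<^sup>2) = total_degree E * stat_inner f f"
    using total_degree_pos
    by (simp add: sum_arcs_fst stat_inner_def stat_eq sum_distrib_left power2_eq_square mult_ac)
  moreover have "(\<Sum>(u, v)\<in>{(u, v). E u v}. (f $ v)\<^sup>2) = (\<Sum>(u, v)\<in>{(u, v). E u v}. (f $ u)\<^sup>2)"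
    by (rule sum_arcs_swap)
  ultimately show ?thesis by (simp add: case_prod_unfold sum.distrib)
qed

lemma dirichlet_identity:
  "4 * total_degree E * stat_inner f (f - P *v f) = dirichlet_sum E f"
proof -
  have "dirichlet_sum E f = (\<Sum>(u, v)\<in>{(u, v). E u v}. ((f $ u)\<^sup>2 + (f $ v)\<^sup>2) - 2 * (f $ u * f $ v))"
    unfolding dirichlet_sum_def by (intro sum.cong) (auto simp: power2_eq_square algebra_simps)
  also have "\<dots> = 2 * total_degree E * stat_inner f f - 2 * (\<Sum>(u, v)\<in>{(u, v). E u v}. f $ u * f $ v)"
    using sum_arcs_squares[of f] by (simp add: case_prod_unfold sum_subtractf sum_distrib_left)
  finally show ?thesis
    using stat_inner_walk[of f] by (simp add: stat_inner_linear algebra_simps)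
qed

text \<open>
  This is where laziness matters: the holding probability one half is just enough to complete
  the adjacency form to a sum of the squares \<open>(f(u) + f(v))\<^sup>2\<close>.
\<close>

lemma walk_semidefinite: "stat_inner f (P *v f) \<ge> 0"
proof -
  have "0 \<le> (\<Sum>(u, v)\<in>{(u, v). E u v}. (f $ u + f $ v)\<^sup>2)" by (intro sum_nonneg) auto
  also have "\<dots> = (\<Sum>(u, v)\<in>{(u, v). E u v}. ((f $ u)\<^sup>2 + (f $ v)\<^sup>2) + 2 * (f $ u * f $ v))"
    by (intro sum.cong) (auto simp: power2_eq_square algebra_simps)
  also have "\<dots> = 2 * total_degree E * stat_inner f f + 2 * (\<Sum>(u, v)\<in>{(u, v). E u v}. f $ u * f $ v)"
    using sum_arcs_squares[of f] by (simp add: case_prod_unfold sum.distrib sum_distrib_left)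
  finally have "0 \<le> 4 * total_degree E * stat_inner f (P *v f)"
    using stat_inner_walk[of f] by (simp add: algebra_simps)
  then show ?thesis using total_degree_pos by (simp add: zero_le_mult_iff)
qed

lemma dirichlet_sum_nonneg: "dirichlet_sum E f \<ge> 0"
  unfolding dirichlet_sum_def by (intro sum_nonneg) auto

lemma walk_contraction: "stat_inner f (f - P *v f) \<ge> 0"
  using dirichlet_sum_nonneg[of f] total_degree_pos
  by (simp add: dirichlet_identity[symmetric] zero_le_mult_iff)

lemma dirichlet_sum_eq_0_const:
  assumes "dirichlet_sum E f = 0"
  shows "f $ u = f $ v"
proof -
  have edge: "f $ a = f $ b" if "E a b" for a b
  proof -
    have "\<forall>p\<in>{(u, v). E u v}. (case p of (u, v) \<Rightarrow> (f $ u - f $ v)\<^sup>2) = 0"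
      using assms unfolding dirichlet_sum_def by (subst sum_nonneg_eq_0_iff[symmetric]) auto
    then show ?thesis using that by auto
  qed
  have "E\<^sup>*\<^sup>* u v" using connected by (simp add: connected_graph_def)
  then show ?thesis by (induction rule: rtranclp_induct) (auto dest: edge)
qed

text \<open>
  By connectedness a function without energy is constant, and a constant of mean zero vanishes.
\<close>

lemma mean_zero_dirichlet_pos:
  assumes "stat_inner f 1 = 0" "f \<noteq> 0"
  shows "stat_inner f (f - P *v f) > 0"
proof (rule ccontr)
  assume "\<not> ?thesis"
  then have "stat_inner f (f - P *v f) = 0" using walk_contraction[of f] by simp
  then have const: "f $ u = f $ v" for u v
    using dirichlet_sum_eq_0_const[of f] dirichlet_identity[of f] by simp
  fix z
  have "f = (f $ z) *\<^sub>R 1" using const by (simp add: vec_eq_iff)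
  then have "stat_inner f 1 = f $ z"
    by (metis mult.right_neutral stat_inner_one_one stat_inner_scaleR_left)
  with assms(1) have "f $ z = 0" by simp
  with assms(2) const show False by (metis vec_eq_iff zero_index)
qed

lemma bilinear_stat_inner_walk: "bilinear (\<lambda>f g. stat_inner f (P *v g))"
  unfolding bilinear_def
  by (auto intro!: linearI simp: stat_inner_linear matrix_vector_right_distrib matrix_vector_mult_scaleR)

lemma bilinear_spectral_gap_form: "bilinear (\<lambda>f g. c * stat_inner f g - stat_inner f (P *v g))"
  unfolding bilinear_def
  by (auto intro!: linearI simp: stat_inner_linear matrix_vector_right_distrib matrix_vector_mult_scaleR algebra_simps)

lemma subspace_mean_zero: "subspace {f. stat_inner f 1 = 0}"
  by (auto simp: subspace_def stat_inner_linear)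

section \<open>The spectral gap\<close>

lemma exists_mean_zero: "\<exists>f. f \<noteq> 0 \<and> stat_inner f 1 = 0"
proof -
  fix x :: 'v
  define a :: "real ^ 'v" where "a = axis x 1"
  have "UNIV \<noteq> {x}"
  proof
    assume "UNIV = {x}"
    then have "CARD('v) = card {x}" by (rule arg_cong)
    with two_vertices show False by simp
  qed
  then obtain y where "y \<noteq> x" by blast
  then have "a $ x \<noteq> a $ y" by (simp add: a_def axis_def)
  then have "a - stat_inner a 1 *\<^sub>R 1 \<noteq> 0"
    by (metis eq_iff_diff_eq_0 one_index vector_scaleR_component)
  moreover have "stat_inner (a - stat_inner a 1 *\<^sub>R 1) 1 = 0"
    by (simp add: stat_inner_linear stat_inner_one_one)
  ultimately show ?thesis by blast
qed

lemma continuous_on_stat_inner [continuous_intros]: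
  "continuous_on S f \<Longrightarrow> continuous_on S g \<Longrightarrow> continuous_on S (\<lambda>z. stat_inner (f z) (g z))"
  unfolding stat_inner_def by (intro continuous_intros)

text \<open>
  The Rayleigh quotient is continuous on the compact Euclidean unit sphere of the space of mean
  zero functions, and homogeneous of degree zero. The conclusion is stated without division so
  that it covers \<open>f = 0\<close>.
\<close>

lemma rayleigh_maximizer:
  obtains g where "g \<noteq> 0" "stat_inner g 1 = 0"
    and "\<And>f. stat_inner f 1 = 0 \<Longrightarrow>
      stat_inner f (P *v f) * stat_inner g g \<le> stat_inner g (P *v g) * stat_inner f f"
proof -
  define K where "K = sphere 0 1 \<inter> {f. stat_inner f 1 = 0}"
  define R where "R f = stat_inner f (P *v f) / stat_inner f f" for f
  have nonzero: "f \<noteq> 0" if "f \<in> K" for f using that by (auto simp: K_def)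
  have "closed {f. stat_inner f 1 = 0}"
    by (intro closed_Collect_eq continuous_intros)
  then have "compact K" unfolding K_def by (intro compact_Int_closed) auto
  have normalized: "f /\<^sub>R norm f \<in> K" if "f \<noteq> 0" "stat_inner f 1 = 0" for f
    using that by (simp add: K_def stat_inner_linear)
  have "K \<noteq> {}" using exists_mean_zero normalized by blast
  have "continuous_on K R"
    unfolding R_def using nonzero
    by (intro continuous_intros linear_continuous_on_compose) (auto simp: stat_inner_self_eq_0_iff linear_matrix_vector_mul_eq)
  then obtain g where g: "g \<in> K" "\<And>f. f \<in> K \<Longrightarrow> R f \<le> R g"
    using continuous_attains_sup[OF \<open>compact K\<close> \<open>K \<noteq> {}\<close>] by blast
  have pos: "stat_inner f f > 0" if "f \<noteq> 0" for f
    using that stat_inner_self_nonneg[of f] stat_inner_self_eq_0_iff[of f] by linarith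
  show thesis
  proof (rule that)
    show "g \<noteq> 0" using g nonzero by blast
    show "stat_inner g 1 = 0" using g by (simp add: K_def)
    fix f assume f: "stat_inner f 1 = 0"
    show "stat_inner f (P *v f) * stat_inner g g \<le> stat_inner g (P *v g) * stat_inner f f"
    proof (cases "f = 0")
      case False
      have "R f = R (f /\<^sub>R norm f)"
        using False by (simp add: R_def stat_inner_linear matrix_vector_mult_scaleR)
      also have "\<dots> \<le> R g" using g normalized[OF False f] by blast
      finally show ?thesis
        using pos[OF False] pos[OF \<open>g \<noteq> 0\<close>] by (simp add: R_def field_simps)
    qed simp
  qed
qed

text \<open>
  Euler's equation at a maximizer \<open>g\<close>: the form \<open>\<mu> \<langle>f, k\<rangle> - \<langle>f, P k\<rangle>\<close> is semidefinite on mean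
  zero functions and vanishes on \<open>(g, g)\<close>, so by the Cauchy-Schwarz inequality \<open>g\<close> lies in its
  radical; testing with \<open>k = \<mu> g - P g\<close> itself shows that \<open>g\<close> is an eigenvector.
\<close>

lemma spectral_gap_attained:
  obtains \<mu> g where "g \<noteq> 0" "P *v g = \<mu> *\<^sub>R g" "\<mu> < 1"
    and "\<And>f. stat_inner f 1 = 0 \<Longrightarrow> stat_inner f (P *v f) \<le> \<mu> * stat_inner f f"
proof -
  obtain g where g: "g \<noteq> 0" "stat_inner g 1 = 0"
    and max: "\<And>f. stat_inner f 1 = 0 \<Longrightarrow>
      stat_inner f (P *v f) * stat_inner g g \<le> stat_inner g (P *v g) * stat_inner f f"
    using rayleigh_maximizer by blast
  have pos: "stat_inner g g > 0"
    using g stat_inner_self_nonneg[of g] stat_inner_self_eq_0_iff[of g] by linarith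
  define \<mu> where "\<mu> = stat_inner g (P *v g) / stat_inner g g"
  have rayleigh: "stat_inner f (P *v f) \<le> \<mu> * stat_inner f f" if "stat_inner f 1 = 0" for f
    using max[OF that] pos by (simp add: \<mu>_def field_simps)
  define B where "B f k = \<mu> * stat_inner f k - stat_inner f (P *v k)" for f k
  define k where "k = \<mu> *\<^sub>R g - P *v g"
  have k: "stat_inner k 1 = 0"
    using g by (simp add: k_def stat_inner_linear walk_preserves_mean)
  have "(B k g)\<^sup>2 \<le> B k k * B g g"
  proof (rule semidefinite_form_Cauchy_Schwarz[OF _ _ subspace_mean_zero])
    show "bilinear B" unfolding B_def by (rule bilinear_spectral_gap_form)
    show "B f h = B h f" for f h
      using walk_self_adjoint[of f h] by (simp add: B_def stat_inner_commute)
    show "B f f \<ge> 0" if "f \<in> {f. stat_inner f 1 = 0}" for f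
      using rayleigh that by (simp add: B_def)
  qed (use g k in auto)
  also have "B g g = 0" using pos by (simp add: B_def \<mu>_def)
  finally have "B k g = 0" by simp
  moreover have "B k g = stat_inner k k" by (simp add: B_def k_def stat_inner_linear)
  ultimately have "P *v g = \<mu> *\<^sub>R g" by (simp add: stat_inner_self_eq_0_iff k_def)
  moreover have "\<mu> < 1"
    using mean_zero_dirichlet_pos[OF g(2,1)] pos by (simp add: \<mu>_def stat_inner_linear)
  ultimately show thesis using that g rayleigh by blast
qed

lemma eigenvalue_le_one:
  assumes "v \<noteq> 0" "P *v v = c *\<^sub>R v"
  shows "c \<le> 1"
proof -
  have "stat_inner v (v - P *v v) = (1 - c) * stat_inner v v"
    using assms by (simp add: stat_inner_linear algebra_simps)
  then have "(1 - c) * stat_inner v v \<ge> 0" using walk_contraction[of v] by simp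
  moreover have "stat_inner v v > 0"
    using assms stat_inner_self_nonneg[of v] stat_inner_self_eq_0_iff[of v] by linarith
  ultimately show ?thesis by (simp add: zero_le_mult_iff)
qed

lemma charpoly_walk_simple_root: "order 1 (charpoly P) = 1"
proof (rule charpoly_simple_root[of "stat"])
  show "(\<Sum>i\<in>UNIV. stat i * P $ i $ j) = 1 * stat j" for j
    using walk_stationary_stationary[OF simple connected two_vertices] by simp
  show "stat i > 0" for i by (rule stat_pos)
  fix v assume v: "P *v v = 1 *\<^sub>R v" "(\<Sum>i\<in>UNIV. stat i * v $ i) = 0"
  then have "stat_inner v 1 = 0" by (simp add: stat_inner_def)
  with v(1) show "v = 0" using mean_zero_dirichlet_pos[of v] by auto
qed

text \<open>
  The maximum \<open>\<mu>\<close> of the Rayleigh quotient is an eigenvalue below the simple top eigenvalue 1, so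
  it can be at most the second entry. That this entry stays below 1 is what makes the relaxation time
  positive.
\<close>

lemma second_eigenvalue:
  shows "eigenvalue_list P ! 1 < 1"
    and "stat_inner f 1 = 0 \<Longrightarrow> stat_inner f (P *v f) \<le> eigenvalue_list P ! 1 * stat_inner f f"
proof -
  obtain \<mu> g where g: "g \<noteq> 0" "P *v g = \<mu> *\<^sub>R g" and "\<mu> < 1"
    and rayleigh: "\<And>f. stat_inner f 1 = 0 \<Longrightarrow> stat_inner f (P *v f) \<le> \<mu> * stat_inner f f"
    using spectral_gap_attained by blast
  \<comment> \<open>The number 2 is not an eigenvalue, so the polynomial is not zero.\<close>
  have nz: "charpoly P \<noteq> 0"
    using charpoly_root_iff_eigenvalue[of P 2] eigenvalue_le_one[of _ 2] by fastforce
  then have mem: "c \<in># proots (charpoly P) \<longleftrightarrow> (\<exists>v. v \<noteq> 0 \<and> P *v v = c *\<^sub>R v)" for c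
    by (simp add: charpoly_root_iff_eigenvalue)
  have second: "\<mu> \<le> eigenvalue_list P ! 1" "eigenvalue_list P ! 1 < 1"
    unfolding eigenvalue_list_def
    using second_largest_of_mset[of "proots (charpoly P)" 1 \<mu>] nz g \<open>\<mu> < 1\<close> eigenvalue_le_one
    by (auto simp: charpoly_walk_simple_root mem simp del: set_count_proots)
  show "eigenvalue_list P ! 1 < 1" by (rule second)
  assume f: "stat_inner f 1 = 0"
  have "\<mu> * stat_inner f f \<le> eigenvalue_list P ! 1 * stat_inner f f"
    using second stat_inner_self_nonneg by (intro mult_right_mono) auto
  with rayleigh[OF f] show "stat_inner f (P *v f) \<le> eigenvalue_list P ! 1 * stat_inner f f"
    by linarith
qed

section \<open>Moments of the walk\<close>

lemma walk_power_self_adjoint: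
  "stat_inner (matrix_power P n *v f) g = stat_inner f (matrix_power P n *v g)"
proof (induction n arbitrary: f g)
  case (Suc n)
  have "stat_inner (matrix_power P (Suc n) *v f) g = stat_inner f (matrix_power P n *v (P *v g))"
    by (simp only: matrix_power_Suc_vector walk_self_adjoint Suc)
  also have "matrix_power P n *v (P *v g) = matrix_power P (Suc n) *v g"
    using matrix_power_add_vector[of P n 1 g] by simp
  finally show ?case .
qed simp

definition moment :: "real ^ 'v \<Rightarrow> nat \<Rightarrow> real" where
  "moment f n = stat_inner f (matrix_power P n *v f)"

lemma moment_add: "moment f (m + n) = stat_inner (matrix_power P m *v f) (matrix_power P n *v f)"
  by (simp only: moment_def matrix_power_add_vector walk_power_self_adjoint)

lemma moment_even:
  "moment f (2 * n) = stat_inner (matrix_power P n *v f) (matrix_power P n *v f)"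
  using moment_add[of f n n] by (simp only: mult_2)

lemma moment_odd:
  "moment f (Suc (2 * n)) = stat_inner (matrix_power P n *v f) (P *v (matrix_power P n *v f))"
  using moment_add[of f n "Suc n"] by (simp only: matrix_power_Suc_vector mult_2 add_Suc_right)

lemma moment_nonneg: "moment f n \<ge> 0"
proof (cases "even n")
  case True
  then show ?thesis by (auto elim!: evenE simp: moment_even stat_inner_self_nonneg)
next
  case False
  then show ?thesis by (auto elim!: oddE simp: moment_odd walk_semidefinite)
qed

lemma moment_decrement_even:
  "4 * total_degree E * (moment f (2 * n) - moment f (Suc (2 * n)))
     = dirichlet_sum E (matrix_power P n *v f)"
  by (simp only: moment_even moment_odd stat_inner_diff_right flip: dirichlet_identity)

text \<open>
  The second difference of the moments at time \<open>2 n + 1\<close> is \<open>\<langle>k, P k\<rangle>\<close> for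
  \<open>k = P\<^sup>n f - P\<^sup>n\<^sup>+\<^sup>1 f\<close>. It carries estimates for even times over to odd ones.
\<close>

lemma moment_convex_odd:
  "moment f (2 * Suc n) - moment f (Suc (2 * Suc n)) \<le> moment f (Suc (2 * n)) - moment f (2 * Suc n)"
proof -
  define g where "g = matrix_power P n *v f"
  have "0 \<le> stat_inner (g - P *v g) (P *v (g - P *v g))" by (rule walk_semidefinite)
  also have "\<dots> = stat_inner g (P *v g) - 2 * stat_inner (P *v g) (P *v g)
      + stat_inner (P *v g) (P *v (P *v g))"
    using walk_self_adjoint[of g "P *v g"]
    by (simp add: stat_inner_linear matrix_vector_mult_diff_distrib)
  also have "\<dots> = moment f (Suc (2 * n)) - 2 * moment f (2 * Suc n) + moment f (Suc (2 * Suc n))"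
    by (simp only: moment_odd moment_even matrix_power_Suc_vector g_def)
  finally show ?thesis by simp
qed

lemma moment_antimono_Suc: "moment f (Suc n) \<le> moment f n"
proof (cases "even n")
  case True
  then obtain m where n: "n = 2 * m" by (elim evenE)
  have "0 \<le> total_degree E * (moment f (2 * m) - moment f (Suc (2 * m)))"
    using moment_decrement_even[of f m] dirichlet_sum_nonneg[of "matrix_power P m *v f"] by linarith
  then show ?thesis using n total_degree_pos by (simp add: zero_le_mult_iff)
next
  case False
  then obtain m where n: "n = Suc (2 * m)" by (auto elim!: oddE)
  have "0 \<le> total_degree E * (moment f (2 * Suc m) - moment f (Suc (2 * Suc m)))"
    using moment_decrement_even[of f "Suc m"] dirichlet_sum_nonneg[of "matrix_power P (Suc m) *v f"]
    by linarith
  then have "0 \<le> moment f (2 * Suc m) - moment f (Suc (2 * Suc m))"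
    using total_degree_pos by (simp add: zero_le_mult_iff)
  with moment_convex_odd[of f m] show ?thesis by (simp add: n)
qed

lemma moment_antimono: "antimono (moment f)"
  by (rule decseq_SucI) (rule moment_antimono_Suc)

lemma power_preserves_mean: "stat_inner (matrix_power P n *v f) 1 = stat_inner f 1"
  by (induction n) (simp_all only: matrix_power.simps(1) matrix_vector_mul_lid
      matrix_power_Suc_vector walk_preserves_mean)

text \<open>
  For even times this is the Rayleigh bound for \<open>g = P\<^sup>m f\<close>. For odd times it is the bound
  \<open>\<langle>P g, P g\<rangle> \<le> c \<langle>g, P g\<rangle>\<close>, which follows from the Cauchy-Schwarz inequality for the
  form \<open>\<langle>f, P k\<rangle>\<close> applied to \<open>g\<close> and \<open>P g\<close>.
\<close>

lemma moment_contraction: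
  assumes f: "stat_inner f 1 = 0"
    and gap: "\<And>g. stat_inner g 1 = 0 \<Longrightarrow> stat_inner g (P *v g) \<le> c * stat_inner g g"
  shows "moment f (Suc n) \<le> c * moment f n"
proof (cases "even n")
  case True
  then obtain m where n: "n = 2 * m" by (elim evenE)
  show ?thesis
    unfolding n moment_odd moment_even by (intro gap) (simp add: power_preserves_mean f)
next
  case False
  then obtain m where n: "n = Suc (2 * m)" by (auto elim!: oddE)
  define g where "g = matrix_power P m *v f"
  have g: "stat_inner g 1 = 0" by (simp add: g_def power_preserves_mean f)
  define q where "q = stat_inner (P *v g) (P *v g)"
  have "(stat_inner g (P *v (P *v g)))\<^sup>2
      \<le> stat_inner g (P *v g) * stat_inner (P *v g) (P *v (P *v g))"
    by (rule semidefinite_form_Cauchy_Schwarz[OF bilinear_stat_inner_walk _ subspace_UNIV])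
      (simp_all add: walk_semidefinite, metis stat_inner_commute walk_self_adjoint)
  also have "stat_inner g (P *v (P *v g)) = q"
    by (simp add: q_def walk_self_adjoint)
  also have "stat_inner g (P *v g) * stat_inner (P *v g) (P *v (P *v g))
      \<le> stat_inner g (P *v g) * (c * q)"
    unfolding q_def
    by (intro mult_left_mono gap walk_semidefinite) (simp add: walk_preserves_mean g)
  finally have *: "q * q \<le> (c * stat_inner g (P *v g)) * q"
    by (simp add: power2_eq_square mult_ac)
  have "q \<le> c * stat_inner g (P *v g)"
  proof (cases "q = 0")
    case False
    then have "q > 0" using stat_inner_self_nonneg[of "P *v g"] by (simp add: q_def)
    with * show ?thesis by simp
  next
    case True
    then have "P *v g = 0" by (simp add: q_def stat_inner_self_eq_0_iff)
    then show ?thesis using True by simp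
  qed
  moreover have "moment f (Suc n) = q"
    using moment_even[of f "Suc m"] by (simp only: n matrix_power_Suc_vector q_def g_def) simp
  ultimately show ?thesis by (simp add: n moment_odd g_def)
qed

section \<open>A Nash inequality\<close>

lemma min_degree_le: "real (min_degree E) \<le> deg u"
  by (simp add: min_degree_def)

lemma min_degree_pos: "real (min_degree E) > 0"
proof -
  have "min_degree E \<in> range (degree_of E)" unfolding min_degree_def by (intro Min_in) auto
  then show ?thesis using deg_pos by auto
qed

text \<open>
  The Dirichlet sum runs over arcs and so counts every edge twice, whence the factor 2 for a set
  \<open>F\<close> that contains each edge in at most one direction.
\<close>

lemma dirichlet_sum_ge:
  assumes F: "\<And>u v. (u, v) \<in> F \<Longrightarrow> E u v" and anti: "\<And>u v. (u, v) \<in> F \<Longrightarrow> (v, u) \<notin> F"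
  shows "2 * (\<Sum>(u, v)\<in>F. (f $ u - f $ v)\<^sup>2) \<le> dirichlet_sum E f"
proof -
  have "(\<Sum>(u, v)\<in>prod.swap ` F. (f $ u - f $ v)\<^sup>2) = (\<Sum>(u, v)\<in>F. (f $ u - f $ v)\<^sup>2)"
    by (subst sum.reindex) (auto simp: case_prod_unfold power2_commute)
  then have "2 * (\<Sum>(u, v)\<in>F. (f $ u - f $ v)\<^sup>2)
      = (\<Sum>(u, v)\<in>F \<union> prod.swap ` F. (f $ u - f $ v)\<^sup>2)"
    using anti by (subst sum.union_disjoint) auto
  also have "\<dots> \<le> dirichlet_sum E f"
    unfolding dirichlet_sum_def using F by (intro sum_mono2) (auto simp: adjacent_sym)
  finally show ?thesis .
qed

text \<open>
  The total drop along the path is the sum of the drops over its edges, to which the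
  Cauchy-Schwarz inequality applies.
\<close>

lemma dirichlet_sum_ge_path:
  assumes arcs: "\<And>i. i < r \<Longrightarrow> E (p i) (p (Suc i))" and inj: "inj_on p {..r}"
  shows "2 * (f $ p 0 - f $ p r)\<^sup>2 \<le> real r * dirichlet_sum E f"
proof -
  define F where "F = (\<lambda>i. (p i, p (Suc i))) ` {..<r}"
  have "(f $ p 0 - f $ p r)\<^sup>2 = (\<Sum>i<r. f $ p i - f $ p (Suc i))\<^sup>2"
    by (simp add: sum_lessThan_telescope'[of "\<lambda>i. f $ p i"])
  also have "\<dots> \<le> (\<Sum>i<r. 1\<^sup>2) * (\<Sum>i<r. (f $ p i - f $ p (Suc i))\<^sup>2)"
    using Cauchy_Schwarz_ineq_sum[of "\<lambda>_. 1" "\<lambda>i. f $ p i - f $ p (Suc i)" "{..<r}"] by simp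
  also have "(\<Sum>i<r. (f $ p i - f $ p (Suc i))\<^sup>2) = (\<Sum>(u, v)\<in>F. (f $ u - f $ v)\<^sup>2)"
    unfolding F_def using inj by (subst sum.reindex) (auto intro!: inj_onI dest: inj_onD)
  finally have "2 * (f $ p 0 - f $ p r)\<^sup>2 \<le> real r * (2 * (\<Sum>(u, v)\<in>F. (f $ u - f $ v)\<^sup>2))"
    by simp
  also have "\<dots> \<le> real r * dirichlet_sum E f"
  proof (intro mult_left_mono dirichlet_sum_ge)
    show "E u v" if "(u, v) \<in> F" for u v using that arcs by (auto simp: F_def)
    show "(v, u) \<notin> F" if uv: "(u, v) \<in> F" for u v
    proof
      assume "(v, u) \<in> F"
      with uv obtain i j where ij: "i < r" "j < r" "p i = p (Suc j)" "p (Suc i) = p j"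
        by (auto simp: F_def)
      then have "i = Suc j" "Suc i = j"
        using inj_onD[OF inj ij(3)] inj_onD[OF inj ij(4)] ij(1,2) by simp_all
      then show False by simp
    qed
  qed simp
  finally show ?thesis .
qed

lemma sum_deg_eq_total_degree: "stat_inner f 1 = 1 \<Longrightarrow> (\<Sum>u\<in>UNIV. deg u * f $ u) = total_degree E"
  using total_degree_pos
  by (simp add: stat_inner_def stat_eq field_simps flip: sum_divide_distrib)

lemma neighbourhood_mass:
  assumes "\<And>y. y \<in> S \<Longrightarrow> h \<le> f $ y" "0 \<le> h" "S \<subseteq> A" "finite A" "\<And>y. y \<in> A \<Longrightarrow> 0 \<le> f $ y"
  shows "real (card S) * (real (min_degree E) * h) \<le> (\<Sum>y\<in>A. deg y * f $ y)"
proof -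
  have "real (card S) * (real (min_degree E) * h) = (\<Sum>y\<in>S. real (min_degree E) * h)" by simp
  also have "\<dots> \<le> (\<Sum>y\<in>S. deg y * f $ y)"
    using assms min_degree_le by (intro sum_mono mult_mono) auto
  also have "\<dots> \<le> (\<Sum>y\<in>A. deg y * f $ y)"
    using assms by (intro sum_mono2) auto
  finally show ?thesis .
qed

text \<open>
  Double counting of the pairs of a path vertex \<open>p i\<close> and a neighbour \<open>y\<close> of it, weighted by the
  mass at \<open>y\<close>. Each path vertex has at least \<open>\<delta>\<close> neighbours, each of degree at least \<open>\<delta>\<close>.
  Conversely a vertex \<open>y\<close> adjacent to \<open>p i\<close> and \<open>p j\<close> is a detour of length 2 between them, so on
  a path without shortcuts \<open>j \<le> i + 2\<close> and \<open>y\<close> is counted at most three times.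
\<close>

lemma geodesic_mass:
  fixes p :: "nat \<Rightarrow> 'v"
  assumes f: "\<And>u. 0 \<le> f $ u" "stat_inner f 1 = 1" and h: "0 \<le> h"
    and geodesic: "\<And>i j m. j < k \<Longrightarrow> (E ^^ m) (p i) (p j) \<Longrightarrow> i < k \<Longrightarrow> j \<le> i + m"
    and high: "\<And>i y. i < k \<Longrightarrow> E (p i) y \<Longrightarrow> h \<le> f $ y"
  shows "real k * (real (min_degree E))\<^sup>2 * h \<le> 3 * total_degree E"
proof -
  have few: "card {i \<in> {..<k}. E (p i) y} \<le> 3" for y
  proof (cases "{i \<in> {..<k}. E (p i) y} = {}")
    case False
    define a where "a = Min {i \<in> {..<k}. E (p i) y}"
    have a: "a < k" "E (p a) y" using Min_in[OF _ False] by (auto simp: a_def)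
    have "i \<in> {a..a + 2}" if i: "i < k" "E (p i) y" for i
    proof -
      have "E y (p i)" using i adjacent_sym by simp
      with a(2) have "(E ^^ 2) (p a) (p i)" by (auto simp: numeral_2_eq_2)
      from geodesic[OF i(1) this a(1)] show ?thesis using i by (auto simp: a_def)
    qed
    then have "card {i \<in> {..<k}. E (p i) y} \<le> card {a..a + 2}" by (intro card_mono) auto
    then show ?thesis by simp
  next
    case True
    show ?thesis unfolding True by simp
  qed
  have "real k * (real (min_degree E))\<^sup>2 * h = (\<Sum>i<k. real (min_degree E) * (real (min_degree E) * h))"
    by (simp add: power2_eq_square)
  also have "\<dots> \<le> (\<Sum>i<k. deg (p i) * (real (min_degree E) * h))"
    using min_degree_le h by (intro sum_mono mult_right_mono) auto
  also have "\<dots> \<le> (\<Sum>i<k. \<Sum>y | E (p i) y. deg y * f $ y)"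
  proof (rule sum_mono)
    fix i assume "i \<in> {..<k}"
    then show "deg (p i) * (real (min_degree E) * h) \<le> (\<Sum>y | E (p i) y. deg y * f $ y)"
      using neighbourhood_mass[of "{y. E (p i) y}" h f "{y. E (p i) y}"] f h high
      by (simp add: degree_of_def)
  qed
  also have "\<dots> = (\<Sum>i<k. \<Sum>y\<in>UNIV. if E (p i) y then deg y * f $ y else 0)"
    by (simp add: sum.If_cases)
  also have "\<dots> = (\<Sum>y\<in>UNIV. real (card {i \<in> {..<k}. E (p i) y}) * (deg y * f $ y))"
    by (subst sum.swap) (simp add: sum.If_cases Int_def)
  also have "\<dots> \<le> (\<Sum>y\<in>UNIV. 3 * (deg y * f $ y))"
  proof (intro sum_mono mult_right_mono)
    show "real (card {i \<in> {..<k}. E (p i) y}) \<le> 3" for y using few[of y] by linarith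
  qed (use f in auto)
  also have "\<dots> = 3 * total_degree E"
    by (simp add: sum_deg_eq_total_degree[OF f(2)] flip: sum_distrib_left)
  finally show ?thesis .
qed

text \<open>
  If some neighbour of \<open>x\<close> is already low, there is no vertex whose neighbours are known to be
  high, so a path gives no lower bound on the mass. Instead one compares the neighbours of
  \<open>x\<close>: if at least half of them are high, they carry enough mass to bound \<open>\<delta>\<^sup>2 M\<close>; otherwise at
  least half of the edges at \<open>x\<close> contribute energy, and the mass at \<open>x\<close> itself bounds \<open>\<delta> M\<close>.
\<close>

lemma Nash_adjacent_case:
  assumes f: "\<And>u. 0 \<le> f $ u" "stat_inner f 1 = 1" and M: "f $ x = 1 + M" "M > 0"
    and z: "E x z" "f $ z \<le> 1 + M / 2"
  shows "M ^ 3 * (real (min_degree E))\<^sup>2 \<le> 24 * total_degree E * dirichlet_sum E f"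
proof -
  define d D where "d = real (min_degree E)" and "D = total_degree E"
  have d: "d > 0" and D: "D > 0"
    using min_degree_pos total_degree_pos by (simp_all add: d_def D_def)
  define low high where "low = {y. E x y \<and> f $ y \<le> 1 + M / 2}"
    and "high = {y. E x y \<and> \<not> f $ y \<le> 1 + M / 2}"
  have mass: "(\<Sum>u\<in>UNIV. deg u * f $ u) = D" using sum_deg_eq_total_degree[OF f(2)] by (simp add: D_def)
  have drop: "2 * (real (card S) * (M / 2)\<^sup>2) \<le> dirichlet_sum E f" if "S \<subseteq> low" for S
  proof -
    have "real (card S) * (M / 2)\<^sup>2 = (\<Sum>y\<in>S. (M / 2)\<^sup>2)" by simp
    also have "\<dots> \<le> (\<Sum>y\<in>S. (f $ x - f $ y)\<^sup>2)"
      using that M by (intro sum_mono power_mono) (auto simp: low_def)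
    also have "\<dots> = (\<Sum>(u, v)\<in>Pair x ` S. (f $ u - f $ v)\<^sup>2)"
      by (subst sum.reindex) (auto simp: inj_on_def)
    also have "2 * \<dots> \<le> dirichlet_sum E f"
      using that not_adjacent_self by (intro dirichlet_sum_ge) (auto simp: low_def)
    finally show ?thesis by simp
  qed
  have "{y. E x y} = low \<union> high" by (auto simp: low_def high_def)
  then have "degree_of E x = card low + card high"
    unfolding degree_of_def by (simp add: card_Un_disjoint low_def high_def disjoint_iff)
  then have "d \<le> real (card low) + real (card high)"
    using min_degree_le[of x] by (simp add: d_def)
  then consider "d / 2 \<le> real (card high)" | "d / 2 \<le> real (card low)" by linarith
  then have "M ^ 3 * d\<^sup>2 \<le> 24 * D * dirichlet_sum E f"
  proof cases
    case 1
    have "d / 2 * (d * (M / 2)) \<le> real (card high) * (d * (M / 2))"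
      using 1 d M by (intro mult_right_mono) auto
    also have "\<dots> \<le> D"
      using neighbourhood_mass[of high "M / 2" f UNIV] f M mass
      by (auto simp: high_def d_def)
    finally have "d\<^sup>2 * M \<le> 4 * D" by (simp add: power2_eq_square)
    then have "M ^ 3 * d\<^sup>2 \<le> M\<^sup>2 * (4 * D)"
      using M by (simp add: power3_eq_cube power2_eq_square mult_ac)
    also have "\<dots> \<le> 2 * dirichlet_sum E f * (4 * D)"
      using drop[of "{z}"] z D by (intro mult_right_mono) (auto simp: low_def power2_eq_square)
    also have "\<dots> \<le> 24 * D * dirichlet_sum E f"
      using D dirichlet_sum_nonneg[of f] by simp
    finally show ?thesis .
  next
    case 2
    have "d * M \<le> deg x * f $ x"
      using min_degree_le[of x] M by (intro mult_mono) (auto simp: d_def)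
    also have "\<dots> \<le> D"
      unfolding mass[symmetric] using f by (intro member_le_sum) auto
    finally have dM: "d * M \<le> D" .
    have "M ^ 3 * d\<^sup>2 = (d * M) * (d * M\<^sup>2)" by (simp add: power3_eq_cube power2_eq_square)
    also have "\<dots> \<le> D * (d * M\<^sup>2)" using dM d by (intro mult_right_mono) auto
    also have "\<dots> \<le> D * (4 * dirichlet_sum E f)"
    proof (rule mult_left_mono)
      have "d / 2 * (M / 2)\<^sup>2 \<le> real (card low) * (M / 2)\<^sup>2"
        using 2 by (intro mult_right_mono) auto
      with drop[of low] have "d / 2 * (M / 2)\<^sup>2 \<le> dirichlet_sum E f / 2" by simp
      then show "d * M\<^sup>2 \<le> 4 * dirichlet_sum E f" by (simp add: power_divide)
    qed (use D in simp)
    also have "\<dots> \<le> 24 * D * dirichlet_sum E f"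
      using D dirichlet_sum_nonneg[of f] by simp
    finally show ?thesis .
  qed
  then show ?thesis by (simp add: d_def D_def)
qed

text \<open>
  The case of a path of length at least 2 combines the energy along the path with the mass next
  to it. Only the first \<open>r - 1\<close> path vertices are used for the mass, because their neighbours have
  distance less than \<open>r\<close> from \<open>x\<close>.
\<close>

lemma Nash_inequality:
  assumes f: "\<And>u. 0 \<le> f $ u" "stat_inner f 1 = 1" and x: "f $ x \<ge> 1"
  shows "(f $ x - 1) ^ 3 * (real (min_degree E))\<^sup>2 \<le> 24 * total_degree E * dirichlet_sum E f"
proof (cases "f $ x = 1")
  case True
  then show ?thesis using total_degree_pos dirichlet_sum_nonneg[of f] by simp
next
  case False
  define M where "M = f $ x - 1"
  have M: "f $ x = 1 + M" "M > 0" using False x by (auto simp: M_def)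
  define Z where "Z = {z. f $ z \<le> 1 + M / 2}"
  \<comment> \<open>The mean of \<open>f\<close> is 1, so \<open>f\<close> cannot exceed 1 everywhere.\<close>
  have "\<exists>z. z \<in> Z"
  proof (rule ccontr)
    assume "\<not> ?thesis"
    then have "1 + M / 2 < f $ z" for z by (simp add: Z_def not_le)
    then have "1 < f $ z" for z using M by (smt (verit) half_gt_zero)
    then have "(\<Sum>u\<in>UNIV. deg u * 1) < (\<Sum>u\<in>UNIV. deg u * f $ u)"
      by (intro sum_strict_mono mult_strict_left_mono deg_pos) auto
    then show False using sum_deg_eq_total_degree[OF f(2)] by (simp add: total_degree_def)
  qed
  then obtain z where z: "z \<in> Z" by blast
  have "E\<^sup>*\<^sup>* x z" using connected by (simp add: connected_graph_def)
  from this z obtain p r where p: "p 0 = x" "p r \<in> Z" "\<And>i. i < r \<Longrightarrow> E (p i) (p (Suc i))"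
    and geodesic: "\<And>i j m. j \<le> r \<Longrightarrow> (E ^^ m) (p i) (p j) \<Longrightarrow> i \<le> r \<Longrightarrow> j \<le> i + m"
    and high: "\<And>k y. (E ^^ k) x y \<Longrightarrow> k < r \<Longrightarrow> y \<notin> Z"
    by (rule geodesic_to_set) (rule that)
  have "r \<noteq> 0"
  proof
    assume "r = 0"
    with p(1,2) M show False by (simp add: Z_def)
  qed
  show ?thesis
  proof (cases "r = 1")
    case True
    then show ?thesis
      using Nash_adjacent_case[OF f M, of "p 1"] p by (simp add: Z_def M_def)
  next
    case False
    define d D where "d = real (min_degree E)" and "D = total_degree E"
    have d: "d > 0" and D: "D > 0"
      using min_degree_pos total_degree_pos by (simp_all add: d_def D_def)
    have "inj_on p {..r}"
    proof (rule inj_onI)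
      fix i j assume "i \<in> {..r}" "j \<in> {..r}" "p i = p j"
      then show "i = j" using geodesic[of j 0 i] geodesic[of i 0 j] by auto
    qed
    then have "2 * (f $ p 0 - f $ p r)\<^sup>2 \<le> real r * dirichlet_sum E f"
      using p(3) by (intro dirichlet_sum_ge_path)
    moreover have "(M / 2)\<^sup>2 \<le> (f $ p 0 - f $ p r)\<^sup>2"
      using p(1,2) M by (intro power_mono) (auto simp: Z_def)
    ultimately have energy: "M\<^sup>2 \<le> 2 * real r * dirichlet_sum E f"
      by (simp add: power2_eq_square)
    have "real (r - 1) * d\<^sup>2 * (M / 2) \<le> 3 * D"
      unfolding d_def D_def
    proof (rule geodesic_mass[OF f])
      fix i y assume i: "i < r - 1" "E (p i) y"
      have "(E ^^ i) x (p i)"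
        unfolding relpowp_fun_conv using p(1,3) i by (intro exI[of _ p]) auto
      with i have "(E ^^ Suc i) x y" by auto
      from high[OF this] i have "y \<notin> Z" by auto
      then show "M / 2 \<le> f $ y" by (simp add: Z_def)
    qed (use geodesic M in auto)
    moreover have "real r \<le> 2 * real (r - 1)" using \<open>r \<noteq> 0\<close> False by linarith
    then have "real r * (d\<^sup>2 * (M / 2)) \<le> 2 * real (r - 1) * (d\<^sup>2 * (M / 2))"
      using M by (intro mult_right_mono) auto
    ultimately have "real r * (d\<^sup>2 * M) \<le> 12 * D" by simp
    then have mass: "real r * (d\<^sup>2 * M) * dirichlet_sum E f \<le> 12 * D * dirichlet_sum E f"
      using dirichlet_sum_nonneg by (intro mult_right_mono)
    have "M ^ 3 * d\<^sup>2 = M\<^sup>2 * (d\<^sup>2 * M)" by (simp add: power3_eq_cube power2_eq_square)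
    also have "\<dots> \<le> 2 * real r * dirichlet_sum E f * (d\<^sup>2 * M)"
      using energy M by (intro mult_right_mono) auto
    also have "\<dots> \<le> 24 * D * dirichlet_sum E f"
      using mass by (simp add: mult_ac)
    finally show ?thesis by (simp add: d_def D_def M_def)
  qed
qed

section \<open>Return probabilities\<close>

lemma walk_entry_nonneg: "0 \<le> P $ u $ v"
  by (simp add: lazy_walk_def)

lemma walk_power_nonneg: "(\<And>u. 0 \<le> f $ u) \<Longrightarrow> 0 \<le> (matrix_power P n *v f) $ u"
proof (induction n arbitrary: u)
  case 0
  then show ?case by simp
next
  case (Suc n)
  have "(matrix_power P (Suc n) *v f) $ u = (\<Sum>v\<in>UNIV. P $ u $ v * (matrix_power P n *v f) $ v)"
    by (simp only: matrix_power_Suc_vector) (simp add: matrix_vector_mult_def)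
  also have "\<dots> \<ge> 0" using Suc walk_entry_nonneg by (intro sum_nonneg) auto
  finally show ?case .
qed

text \<open>
  The density with respect to the stationary distribution of the point mass at \<open>x\<close>. It represents
  evaluation at \<open>x\<close> in the inner product.
\<close>

definition start_density :: "'v \<Rightarrow> real ^ 'v" where
  "start_density x = axis x (1 / stat x)"

lemma stat_inner_start_density: "stat_inner (start_density x) g = g $ x"
proof -
  have "stat_inner (start_density x) g = (\<Sum>u\<in>UNIV. if u = x then g $ x else 0)"
    unfolding stat_inner_def start_density_def using stat_pos[of x]
    by (intro sum.cong) (auto simp: axis_def)
  then show ?thesis by simp
qed

lemma walk_power_start_density:
  "(matrix_power P n *v start_density x) $ x = matrix_power P n $ x $ x / stat x"
  by (simp add: start_density_def matrix_vector_mult_def axis_def if_distrib cong: if_cong)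

lemma walk_power_centred: "matrix_power P n *v (f - 1) = matrix_power P n *v f - 1"
proof -
  have "matrix_power P n *v 1 = 1"
    by (induction n) (simp_all only: matrix_power.simps(1) matrix_vector_mul_lid
        matrix_power_Suc_vector walk_fixes_one)
  then show ?thesis by (simp add: matrix_vector_mult_diff_distrib)
qed

lemma start_density_centred: "stat_inner (start_density x - 1) 1 = 0"
  by (simp add: stat_inner_linear stat_inner_start_density stat_inner_one_one)

lemma moment_eq:
  "moment (start_density x - 1) n = (matrix_power P n *v start_density x) $ x - 1"
proof -
  have "stat_inner 1 (matrix_power P n *v (start_density x - 1)) = 0"
    by (metis power_preserves_mean start_density_centred stat_inner_commute)
  then show ?thesis
    by (simp add: moment_def stat_inner_diff_left stat_inner_start_density walk_power_centred)
qed

lemma moment_Nash_even: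
  fixes x :: 'v
  defines "a \<equiv> moment (start_density x - 1)"
  shows "a n ^ 3 * (real (min_degree E))\<^sup>2 \<le> 96 * (total_degree E)\<^sup>2 * (a (2 * n) - a (Suc (2 * n)))"
proof -
  define f where "f = matrix_power P n *v start_density x"
  have "0 \<le> start_density x $ u" for u
    using stat_pos[of x] by (simp add: start_density_def axis_def)
  then have nonneg: "0 \<le> f $ u" for u unfolding f_def by (rule walk_power_nonneg)
  have mean: "stat_inner f 1 = 1"
    by (simp add: f_def power_preserves_mean stat_inner_start_density)
  have fx: "f $ x = 1 + a n" by (simp add: a_def moment_eq f_def)
  have "a n \<ge> 0" unfolding a_def by (rule moment_nonneg)
  then have "a n ^ 3 * (real (min_degree E))\<^sup>2 \<le> 24 * total_degree E * dirichlet_sum E f"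
    using Nash_inequality[OF nonneg mean, of x] fx by simp
  also have "dirichlet_sum E f = dirichlet_sum E (f - 1)" by (simp add: dirichlet_sum_def)
  also have "\<dots> = 4 * total_degree E * (a (2 * n) - a (Suc (2 * n)))"
    by (simp add: a_def moment_decrement_even walk_power_centred f_def)
  finally show ?thesis by (simp add: power2_eq_square)
qed

text \<open>
  At an odd time the decrement dominates that at the next even time \<open>2 m\<close>, and still \<open>m \<le> n\<close>,
  so that the cube on the left only grows when \<open>n\<close> is replaced by \<open>m\<close>.
\<close>

lemma moment_Nash:
  fixes x :: 'v
  defines "a \<equiv> moment (start_density x - 1)"
  shows "a n ^ 3 * (real (min_degree E))\<^sup>2 \<le> 96 * (total_degree E)\<^sup>2 * (a n - a (Suc n))"
proof -
  have nonneg: "0 \<le> a k" for k unfolding a_def by (rule moment_nonneg)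
  have anti: "a k \<le> a j" if "j \<le> k" for j k
    using moment_antimono that by (auto simp: a_def antimono_def)
  obtain m where m: "m \<le> n" "a (2 * m) - a (Suc (2 * m)) \<le> a n - a (Suc n)"
  proof (cases "even n")
    case True
    then obtain l where "n = 2 * l" by (elim evenE)
    then show thesis using that[of l] by simp
  next
    case False
    then obtain l where "n = Suc (2 * l)" by (auto elim!: oddE)
    then show thesis
      using that[of "Suc l"] moment_convex_odd[of "start_density x - 1" l] by (simp add: a_def)
  qed
  have "a n ^ 3 * (real (min_degree E))\<^sup>2 \<le> a m ^ 3 * (real (min_degree E))\<^sup>2"
    using anti[OF m(1)] nonneg by (intro mult_right_mono power_mono) auto
  also have "\<dots> \<le> 96 * (total_degree E)\<^sup>2 * (a (2 * m) - a (Suc (2 * m)))"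
    unfolding a_def by (rule moment_Nash_even)
  also have "\<dots> \<le> 96 * (total_degree E)\<^sup>2 * (a n - a (Suc n))"
    using m(2) by (intro mult_left_mono) auto
  finally show ?thesis .
qed

lemma second_eigenvalue_nonneg: "0 \<le> eigenvalue_list P ! 1"
proof -
  obtain f where f: "f \<noteq> 0" "stat_inner f 1 = 0" using exists_mean_zero by blast
  have "0 \<le> eigenvalue_list P ! 1 * stat_inner f f"
    using second_eigenvalue(2)[OF f(2)] walk_semidefinite[of f] by linarith
  moreover have "stat_inner f f > 0"
    using f stat_inner_self_nonneg[of f] stat_inner_self_eq_0_iff[of f] by linarith
  ultimately show ?thesis by (simp add: zero_le_mult_iff)
qed

text \<open>
  The rescaled moments \<open>b = a \<delta> / D\<close> start at a value at most 1 because \<open>a\<^sub>0 \<le> D / d\<^sub>x\<close>, and multiplication by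
  \<open>d\<^sub>x / \<delta>\<close> turns \<open>b\<close> into \<open>\<pi>(x) a\<close>.
\<close>

lemma return_probability_bound:
  "matrix_power P t $ x $ x - stat x
    \<le> 10 * deg x / real (min_degree E) *
      min (1 / sqrt (real t + 1)) (sqrt (relaxation_time P + 1) / (real t + 1))"
proof -
  define a where "a = moment (start_density x - 1)"
  define d D where "d = real (min_degree E)" and "D = total_degree E"
  have d: "d > 0" and D: "D > 0"
    using min_degree_pos total_degree_pos by (simp_all add: d_def D_def)
  define b where "b n = a n * (d / D)" for n
  define T where "T = relaxation_time P"
  have T: "1 - inverse T = eigenvalue_list P ! 1" "1 \<le> T"
    using second_eigenvalue(1) second_eigenvalue_nonneg
    by (simp_all add: T_def relaxation_time_def one_le_inverse)
  have a: "a n = matrix_power P n $ x $ x / stat x - 1" for n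
    by (simp add: a_def moment_eq walk_power_start_density)
  have decay: "b t \<le> 10 * min (1 / sqrt (real t + 1)) (sqrt (T + 1) / (real t + 1))"
  proof (rule mixed_decay_bound)
    show "0 \<le> b s" for s using d D by (simp add: b_def a_def moment_nonneg)
    have "a 0 \<le> 1 / stat x" by (simp add: a mat_def)
    then have "b 0 \<le> 1 / stat x * (d / D)"
      unfolding b_def using d D by (intro mult_right_mono) auto
    also have "\<dots> = d / deg x" using D deg_pos[of x] by (simp add: stat_eq D_def)
    also have "\<dots> \<le> 1" using min_degree_le[of x] deg_pos[of x] by (simp add: d_def)
    finally show "b 0 \<le> 1" .
    show "1 / 96 * b s ^ 3 \<le> b s - b (Suc s)" for s
    proof -
      have "a s ^ 3 * d\<^sup>2 \<le> 96 * D\<^sup>2 * (a s - a (Suc s))"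
        unfolding a_def d_def D_def by (rule moment_Nash)
      then have "a s ^ 3 * d\<^sup>2 * (d / D ^ 3 / 96) \<le> 96 * D\<^sup>2 * (a s - a (Suc s)) * (d / D ^ 3 / 96)"
        using d D by (intro mult_right_mono) auto
      also have "\<dots> = b s - b (Suc s)"
        using D by (simp add: b_def field_simps power2_eq_square power3_eq_cube)
      finally show ?thesis
        by (simp add: b_def power_mult_distrib power_divide power2_eq_square power3_eq_cube mult_ac)
    qed
    show "b (Suc s) \<le> (1 - inverse T) * b s" for s
    proof -
      have "a (Suc s) \<le> eigenvalue_list P ! 1 * a s"
        unfolding a_def using second_eigenvalue(2)
        by (intro moment_contraction start_density_centred)
      then show ?thesis
        using d D by (simp add: b_def T divide_right_mono mult_right_mono flip: mult.assoc)
    qed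
    show "1 \<le> T" by (rule T)
  qed
  have "matrix_power P t $ x $ x - stat x = stat x * a t"
    using stat_pos[of x] by (simp add: a field_simps)
  also have "\<dots> = deg x / d * b t"
    using d D by (simp add: b_def stat_eq D_def)
  also have "\<dots> \<le> deg x / d * (10 * min (1 / sqrt (real t + 1)) (sqrt (T + 1) / (real t + 1)))"
    using d decay by (intro mult_left_mono) auto
  also have "\<dots> = 10 * deg x / d * min (1 / sqrt (real t + 1)) (sqrt (T + 1) / (real t + 1))"
    by simp
  finally show ?thesis unfolding d_def T_def .
qed

end

theorem theorem2:
  fixes E :: "('v::finite) graph" and x :: 'v and t :: nat
  assumes "simple_graph E" and "connected_graph E" and "CARD('v) \<ge> 2"
  shows "matrix_power (lazy_walk E) t $ x $ x - walk_stationary E x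
    \<le> 10 * real (degree_of E x) / real (min_degree E) *
      min (1 / sqrt (real t + 1))
          (sqrt (relaxation_time (lazy_walk E) + 1) / (real t + 1))"
proof -
  interpret connected_simple_graph E
    using assms by unfold_locales
  show ?thesis by (rule return_probability_bound)
qed

end
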